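(* If $\{\phi_i\}_{i=1}^M$ is a unit norm frame for $\mathbb{H}^N$, then the (optimal) upper Riesz bound of $\{\phi_i\phi_i^*\}_{i=1}^M$ is at least $M/N$. Moreover, equality holds if and only if $\{\phi_i\}_{i=1}^M$ is a unit norm tight frame.
   Context: $\mathbb{H}$ denotes $\mathbb{R}$ or $\mathbb{C}$, with the usual $\ell_2$ inner product on $\mathbb{H}^N$ (column vectors). $\{\phi_i\}_{i=1}^M\subset\mathbb{H}^N$ is a frame if there are $0<A\le B<\infty$ with $A\|\psi\|^2\le\sum_{i=1}^M|\langle\phi_i,\psi\rangle|^2\le B\|\psi\|^2$ for all $\psi\in\mathbb{H}^N$; tight if one can take $A=B$; unit norm if $\|\phi_i\|=1$ for all $i$. Outer products $\phi\phi^*$ live in $\mathbb{H}^{N\times N}$ with the Frobenius inner product $\langle S,T\rangle_F=\mathrm{Tr}(ST^* )$. The (optimal) upper Riesz bound of a sequence $\{x_i\}_{i=1}^M$ in a finite-dimensional inner product space over $\mathbb{H}$ is the smallest $B$ such that $\|\sum_{i=1}^M a_ix_i\|^2\le B\sum_{i=1}^M|a_i|^2$ for all scalars $(a_i)\in\mathbb{H}^M$; equivalently, the largest eigenvalue of its Gram matrix. *)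

theory Defs
  imports "HOL-Analysis.Analysis" "Jordan_Normal_Form.Conjugate"
begin

text \<open>
  The common abstraction of the scalar fields \<open>\<real>\<close> (with trivial conjugation) and \<open>\<complex>\<close>.
\<close>

class normed_conjugatable_field = real_normed_field + conjugatable_field +
  assumes mult_conjugate_scaleR: "x * conjugate x = (norm x)\<^sup>2 *\<^sub>R 1"

lemma mult_conjugate:
  fixes x :: "'a::normed_conjugatable_field"
  shows "x * conjugate x = of_real ((norm x)\<^sup>2)"
  unfolding of_real_def by (rule mult_conjugate_scaleR)

instance real :: normed_conjugatable_field
  by standard (simp add: power2_eq_square)

instance complex :: normed_conjugatable_field
  by standard (metis complex_norm_square conjugate_complex_def of_real_def of_real_power)

text \<open>
  The library function \<open>inner\<close> on \<open>complex ^ 'n\<close> is the real part of the Hermitian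
  inner product, so the scalar-valued one is defined here. The library's norms on
  \<open>'a ^ 'n\<close> and \<open>'a ^ 'n ^ 'n\<close> are the \<open>\<ell>\<^sub>2\<close> and the Frobenius norm; see \<open>hinner_self\<close>
  and \<open>frobenius_inner_self\<close> below.
\<close>

definition hinner :: "'a::normed_conjugatable_field ^ 'n \<Rightarrow> 'a ^ 'n \<Rightarrow> 'a" where
  "hinner x y = (\<Sum>i\<in>UNIV. x $ i * conjugate (y $ i))"

definition adjoint_matrix ::
    "'a::normed_conjugatable_field ^ 'n ^ 'm \<Rightarrow> 'a ^ 'm ^ 'n" where
  "adjoint_matrix S = (\<chi> i j. conjugate (S $ j $ i))"

definition frobenius_inner ::
    "'a::normed_conjugatable_field ^ 'n ^ 'n \<Rightarrow> 'a ^ 'n ^ 'n \<Rightarrow> 'a" where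
  "frobenius_inner S T = trace (S ** adjoint_matrix T)"

definition outer_product ::
    "'a::normed_conjugatable_field ^ 'n \<Rightarrow> 'a ^ 'n \<Rightarrow> 'a ^ 'n ^ 'n" where
  "outer_product x y = (\<chi> i j. x $ i * conjugate (y $ j))"

lemma hinner_self: "hinner x x = of_real ((norm x)\<^sup>2)"
  by (simp add: hinner_def mult_conjugate norm_vec_def L2_set_def sum_nonneg del: of_real_power)

lemma frobenius_inner_self: "frobenius_inner S S = of_real ((norm S)\<^sup>2)"
  by (simp add: frobenius_inner_def trace_def matrix_matrix_mult_def adjoint_matrix_def
      mult_conjugate norm_vec_def L2_set_def sum_nonneg del: of_real_power)

definition frame_bounds ::
    "nat \<Rightarrow> (nat \<Rightarrow> 'a::normed_conjugatable_field ^ 'n) \<Rightarrow> real \<Rightarrow> real \<Rightarrow> bool" where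
  "frame_bounds M \<phi> A B \<longleftrightarrow> 0 < A \<and> A \<le> B \<and>
     (\<forall>\<psi>. A * (norm \<psi>)\<^sup>2 \<le> (\<Sum>i=1..M. (norm (hinner (\<phi> i) \<psi>))\<^sup>2) \<and>
          (\<Sum>i=1..M. (norm (hinner (\<phi> i) \<psi>))\<^sup>2) \<le> B * (norm \<psi>)\<^sup>2)"

definition is_frame :: "nat \<Rightarrow> (nat \<Rightarrow> 'a::normed_conjugatable_field ^ 'n) \<Rightarrow> bool" where
  "is_frame M \<phi> \<longleftrightarrow> (\<exists>A B. frame_bounds M \<phi> A B)"

definition is_tight_frame :: "nat \<Rightarrow> (nat \<Rightarrow> 'a::normed_conjugatable_field ^ 'n) \<Rightarrow> bool" where
  "is_tight_frame M \<phi> \<longleftrightarrow> (\<exists>A. frame_bounds M \<phi> A A)"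

definition unit_norm :: "nat \<Rightarrow> (nat \<Rightarrow> 'v::real_normed_vector) \<Rightarrow> bool" where
  "unit_norm M \<phi> \<longleftrightarrow> (\<forall>i\<in>{1..M}. norm (\<phi> i) = 1)"

text \<open>
  The library's scalar multiplication \<open>*\<^sub>R\<close> only covers real scalars, hence the scalar
  multiplication is a parameter.
\<close>

definition is_upper_riesz_bound ::
    "('a::normed_conjugatable_field \<Rightarrow> 'v \<Rightarrow> 'v::real_normed_vector)
      \<Rightarrow> nat \<Rightarrow> (nat \<Rightarrow> 'v) \<Rightarrow> real \<Rightarrow> bool" where
  "is_upper_riesz_bound smul M x B \<longleftrightarrow>
     (\<forall>a. (norm (\<Sum>i=1..M. smul (a i) (x i)))\<^sup>2 \<le> B * (\<Sum>i=1..M. (norm (a i))\<^sup>2))"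

definition upper_riesz_bound ::
    "('a::normed_conjugatable_field \<Rightarrow> 'v \<Rightarrow> 'v::real_normed_vector)
      \<Rightarrow> nat \<Rightarrow> (nat \<Rightarrow> 'v) \<Rightarrow> real" where
  "upper_riesz_bound smul M x = (LEAST B. is_upper_riesz_bound smul M x B)"

definition matrix_scale ::
    "'a::normed_conjugatable_field \<Rightarrow> 'a ^ 'n ^ 'm \<Rightarrow> 'a ^ 'n ^ 'm" where
  "matrix_scale c S = map_matrix ((*) c) S"

lemma norm_matrix_scale: "norm (matrix_scale c S) = norm c * norm S"
  by (simp add: matrix_scale_def map_matrix_def norm_vec_def norm_mult L2_set_right_distrib)

text \<open>
  For a nonempty sequence the least upper Riesz bound exists, so that \<open>LEAST\<close> is meaningful.
\<close>

lemma upper_riesz_bound_is_least: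
  fixes smul :: "'a::normed_conjugatable_field \<Rightarrow> 'v \<Rightarrow> 'v::real_normed_vector"
  assumes norm_smul: "\<And>c v. norm (smul c v) = norm c * norm v" and "M \<ge> 1"
  shows "is_upper_riesz_bound smul M x (upper_riesz_bound smul M x)"
    and "is_upper_riesz_bound smul M x B \<Longrightarrow> upper_riesz_bound smul M x \<le> B"
proof -
  let ?P = "is_upper_riesz_bound smul M x"
  let ?L = "\<lambda>a. (norm (\<Sum>i=1..M. smul (a i) (x i)))\<^sup>2"
  let ?N = "\<lambda>a::nat \<Rightarrow> 'a. \<Sum>i=1..M. (norm (a i))\<^sup>2"
  have "?P (\<Sum>i=1..M. (norm (x i))\<^sup>2)"
    unfolding is_upper_riesz_bound_def
  proof
    fix a
    have "norm (\<Sum>i=1..M. smul (a i) (x i)) \<le> (\<Sum>i=1..M. norm (a i) * norm (x i))"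
      by (rule order_trans[OF norm_sum]) (simp add: norm_smul)
    then have "?L a \<le> (\<Sum>i=1..M. norm (a i) * norm (x i))\<^sup>2"
      by (intro power_mono) auto
    also have "\<dots> \<le> (\<Sum>i=1..M. (norm (a i))\<^sup>2) * (\<Sum>i=1..M. (norm (x i))\<^sup>2)"
      by (rule Cauchy_Schwarz_ineq_sum)
    finally show "?L a \<le> (\<Sum>i=1..M. (norm (x i))\<^sup>2) * ?N a" by (simp add: mult.commute)
  qed
  then have ne: "Collect ?P \<noteq> {}" by blast
  have nonneg: "0 \<le> B" if "?P B" for B
  proof -
    have "0 \<le> B * ?N (\<lambda>_. 1)"
      using that unfolding is_upper_riesz_bound_def by (meson order_trans zero_le_power2)
    then show ?thesis using \<open>M \<ge> 1\<close> by (simp add: zero_le_mult_iff)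
  qed
  then have bdd: "bdd_below (Collect ?P)" by (intro bdd_belowI[of _ 0]) simp
  have "closed (\<Inter>a. {B. ?L a \<le> B * ?N a})"
    by (intro closed_INT ballI closed_Collect_le continuous_intros)
  also have "(\<Inter>a. {B. ?L a \<le> B * ?N a}) = Collect ?P"
    by (auto simp: is_upper_riesz_bound_def)
  finally have min: "?P (Inf (Collect ?P))"
    using closed_contains_Inf[OF ne bdd] by simp
  have low: "Inf (Collect ?P) \<le> B" if "?P B" for B
    using cInf_lower[OF _ bdd] that by simp
  have eq: "upper_riesz_bound smul M x = Inf (Collect ?P)"
    unfolding upper_riesz_bound_def by (rule Least_equality[where P = ?P]) (fact min, fact low)
  show "?P (upper_riesz_bound smul M x)" using min eq by simp
  show "?P B \<Longrightarrow> upper_riesz_bound smul M x \<le> B" using low eq by simp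
qed

end

theory Submission
  imports Defs
begin

text \<open>
  Let \<open>S = \<Sum>i. \<phi> i (\<phi> i)\<^sup>*\<close> be the frame operator of a unit norm sequence in dimension \<open>N\<close>.
  Its diagonal is real with trace \<open>M\<close>, so \<open>(M/N) I\<close> is the orthogonal projection
  of \<open>S\<close> onto the multiples of the identity and Pythagoras gives
  \<open>\<parallel>S\<parallel>\<^sup>2 = M\<^sup>2/N + \<parallel>S - (M/N) I\<parallel>\<^sup>2\<close> (\<open>norm_frame_operator\<close>).
  Testing an upper Riesz bound \<open>B\<close> of the outer products on the constant coefficients \<open>1\<close> gives
  \<open>\<parallel>S\<parallel>\<^sup>2 \<le> B M\<close>. Hence \<open>B \<ge> M/N\<close>, and \<open>B = M/N\<close> forces \<open>S = (M/N) I\<close>, which says that the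
  frame is tight.

  Conversely, the Gram matrix of the outer products has the nonnegative entries
  \<open>\<bar>\<langle>\<phi> i, \<phi> j\<rangle>\<bar>\<^sup>2\<close>. For a unit norm tight frame with constant \<open>A\<close> the frame identity at \<open>\<phi> i\<close>
  says that each row of this matrix sums to \<open>A\<close>, so by Schur's test \<open>A\<close> is an upper Riesz bound;
  summing the frame identity over the standard basis shows \<open>A = M/N\<close>.

  All of this is carried out over \<open>\<real>\<close> and \<open>\<complex>\<close> at once.
\<close>

section \<open>Conjugation and coordinates\<close>

lemma norm_conjugate [simp]:
  fixes x :: "'a::normed_conjugatable_field"
  shows "norm (conjugate x) = norm x"
proof (cases "x = 0")
  case False
  have "norm x * norm (conjugate x) = norm x * norm x"
    by (metis mult_conjugate norm_mult norm_of_real abs_of_nonneg zero_le_power2 power2_eq_square)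
  with False show ?thesis by simp
qed simp

lemma norm_vec_squared: "(norm (x :: 'a::real_normed_vector ^ 'n))\<^sup>2 = (\<Sum>k\<in>UNIV. (norm (x $ k))\<^sup>2)"
  by (simp add: norm_vec_def L2_set_def sum_nonneg)

lemma norm_matrix_squared:
  "(norm (X :: 'a::real_normed_vector ^ 'n ^ 'm))\<^sup>2 = (\<Sum>k\<in>UNIV. \<Sum>l\<in>UNIV. (norm (X $ k $ l))\<^sup>2)"
  by (simp add: norm_vec_squared)

lemma sum_matrix_scale_outer_nth:
  "(\<Sum>i\<in>I. matrix_scale (a i) (outer_product (\<phi> i) (\<phi> i))) $ k $ l
     = (\<Sum>i\<in>I. a i * (\<phi> i $ k * conjugate (\<phi> i $ l)))"
  by (simp add: matrix_scale_def map_matrix_def outer_product_def)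

section \<open>The frame operator\<close>

definition frame_operator ::
    "nat \<Rightarrow> (nat \<Rightarrow> 'a::normed_conjugatable_field ^ 'n) \<Rightarrow> 'a ^ 'n ^ 'n" where
  "frame_operator M \<phi> = (\<Sum>i=1..M. outer_product (\<phi> i) (\<phi> i))"

lemma frame_operator_nth:
  "frame_operator M \<phi> $ k $ l = (\<Sum>i=1..M. \<phi> i $ k * conjugate (\<phi> i $ l))"
  by (simp add: frame_operator_def outer_product_def)

lemma frame_operator_diag:
  "frame_operator M \<phi> $ k $ k = of_real (\<Sum>i=1..M. (norm (\<phi> i $ k))\<^sup>2)"
  by (simp add: frame_operator_nth mult_conjugate)

lemma sum_coordinates_unit_norm:
  fixes \<phi> :: "nat \<Rightarrow> 'a::real_normed_vector ^ 'n"
  assumes "unit_norm M \<phi>"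
  shows "(\<Sum>k\<in>UNIV. \<Sum>i=1..M. (norm (\<phi> i $ k))\<^sup>2) = real M"
proof -
  have "(\<Sum>k\<in>UNIV. \<Sum>i=1..M. (norm (\<phi> i $ k))\<^sup>2) = (\<Sum>i=1..M. (norm (\<phi> i))\<^sup>2)"
    unfolding norm_vec_squared by (rule sum.swap)
  also have "\<dots> = (\<Sum>i=1..M. 1)"
    using assms by (intro sum.cong) (auto simp: unit_norm_def)
  finally show ?thesis by simp
qed

text \<open>
  Pythagoras for the projection onto the multiples of the identity: \<open>M/N\<close> is the mean of
  the diagonal entries.
\<close>

lemma norm_frame_operator:
  fixes \<phi> :: "nat \<Rightarrow> 'a::normed_conjugatable_field ^ 'n"
  assumes "unit_norm M \<phi>"
  defines "c \<equiv> real M / real CARD('n)"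
  shows "(norm (frame_operator M \<phi>))\<^sup>2
    = (real M)\<^sup>2 / real CARD('n) + (norm (frame_operator M \<phi> - mat (of_real c)))\<^sup>2"
proof -
  let ?S = "frame_operator M \<phi>"
  define d where "d k = (\<Sum>i=1..M. (norm (\<phi> i $ k))\<^sup>2)" for k
  have sum_d: "(\<Sum>k\<in>UNIV. d k) = real M"
    unfolding d_def by (rule sum_coordinates_unit_norm[OF assms(1)])
  have diag: "?S $ k $ k = of_real (d k)" for k
    by (simp add: frame_operator_diag d_def)
  \<comment> \<open>Subtracting \<open>c I\<close> changes only the diagonal entries, which are real.\<close>
  have entry: "(norm ((?S - mat (of_real c)) $ k $ l))\<^sup>2
      = (norm (?S $ k $ l))\<^sup>2 + (if k = l then c\<^sup>2 - 2 * c * d k else 0)" for k l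
  proof (cases "k = l")
    case True
    have "norm ((of_real (d k) :: 'a) - of_real c) = \<bar>d k - c\<bar>"
      by (metis norm_of_real of_real_diff)
    with True show ?thesis by (simp add: mat_def diag power2_diff)
  qed (simp add: mat_def)
  have "(norm (?S - mat (of_real c)))\<^sup>2 = (norm ?S)\<^sup>2 + (\<Sum>k\<in>UNIV. c\<^sup>2 - 2 * c * d k)"
    unfolding norm_matrix_squared entry by (simp add: sum.distrib)
  also have "(\<Sum>k\<in>UNIV. c\<^sup>2 - 2 * c * d k) = real CARD('n) * c\<^sup>2 - 2 * c * real M"
    by (simp add: sum_subtractf sum_d flip: sum_distrib_left)
  also have "\<dots> = - ((real M)\<^sup>2 / real CARD('n))"
    by (simp add: c_def power2_eq_square field_simps)
  finally show ?thesis by simp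
qed

text \<open>
  Frame inequalities are bounds on the quadratic form \<open>\<psi>\<^sup>* S \<psi>\<close> of the frame operator, so a scalar
  frame operator means a tight frame.
\<close>

lemma sum_frame_coefficients:
  fixes \<phi> :: "nat \<Rightarrow> 'a::normed_conjugatable_field ^ 'n"
  shows "of_real (\<Sum>i=1..M. (norm (hinner (\<phi> i) \<psi>))\<^sup>2)
    = (\<Sum>k\<in>UNIV. \<Sum>l\<in>UNIV. conjugate (\<psi> $ k) * \<psi> $ l * frame_operator M \<phi> $ k $ l)"
proof -
  have "of_real (\<Sum>i=1..M. (norm (hinner (\<phi> i) \<psi>))\<^sup>2)
      = (\<Sum>i=1..M. hinner (\<phi> i) \<psi> * conjugate (hinner (\<phi> i) \<psi>))"
    by (simp add: mult_conjugate)
  also have "\<dots> = (\<Sum>i=1..M. \<Sum>k\<in>UNIV. \<Sum>l\<in>UNIV.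
      conjugate (\<psi> $ k) * \<psi> $ l * (\<phi> i $ k * conjugate (\<phi> i $ l)))"
    unfolding hinner_def sum_conjugate[OF finite] sum_product
    by (simp only: conjugate_dist_mul conjugate_id mult_ac)
  also have "\<dots> = (\<Sum>k\<in>UNIV. \<Sum>i=1..M. \<Sum>l\<in>UNIV.
      conjugate (\<psi> $ k) * \<psi> $ l * (\<phi> i $ k * conjugate (\<phi> i $ l)))"
    by (rule sum.swap)
  also have "\<dots> = (\<Sum>k\<in>UNIV. \<Sum>l\<in>UNIV. \<Sum>i=1..M.
      conjugate (\<psi> $ k) * \<psi> $ l * (\<phi> i $ k * conjugate (\<phi> i $ l)))"
    by (intro sum.cong refl sum.swap)
  finally show ?thesis by (simp add: frame_operator_nth sum_distrib_left)
qed

lemma frame_bounds_if_frame_operator_scalar: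
  fixes \<phi> :: "nat \<Rightarrow> 'a::normed_conjugatable_field ^ 'n"
  assumes "frame_operator M \<phi> = mat (of_real c)" and "c > 0"
  shows "frame_bounds M \<phi> c c"
proof -
  have "(\<Sum>i=1..M. (norm (hinner (\<phi> i) \<psi>))\<^sup>2) = c * (norm \<psi>)\<^sup>2" for \<psi>
  proof -
    have "(\<Sum>l\<in>UNIV. conjugate (\<psi> $ k) * \<psi> $ l * frame_operator M \<phi> $ k $ l)
        = of_real (c * (norm (\<psi> $ k))\<^sup>2)" for k
    proof -
      have "(\<Sum>l\<in>UNIV. conjugate (\<psi> $ k) * \<psi> $ l * frame_operator M \<phi> $ k $ l)
          = (\<Sum>l\<in>UNIV. if k = l then (\<psi> $ l * conjugate (\<psi> $ l)) * of_real c else 0)"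
        unfolding assms(1) by (intro sum.cong) (auto simp: mat_def)
      then show ?thesis by (simp add: mult_conjugate)
    qed
    then have "(of_real (\<Sum>i=1..M. (norm (hinner (\<phi> i) \<psi>))\<^sup>2) :: 'a)
        = (\<Sum>k\<in>UNIV. of_real (c * (norm (\<psi> $ k))\<^sup>2))"
      by (simp only: sum_frame_coefficients)
    also have "\<dots> = of_real (c * (norm \<psi>)\<^sup>2)"
      by (simp only: norm_vec_squared of_real_sum sum_distrib_left)
    finally have "(of_real (\<Sum>i=1..M. (norm (hinner (\<phi> i) \<psi>))\<^sup>2) :: 'a) = of_real (c * (norm \<psi>)\<^sup>2)" .
    then show ?thesis by (simp only: of_real_eq_iff)
  qed
  with \<open>c > 0\<close> show ?thesis by (simp add: frame_bounds_def)
qed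

section \<open>Upper Riesz bounds of the outer products\<close>

lemma upper_riesz_bound_frame_operator:
  fixes \<phi> :: "nat \<Rightarrow> 'a::normed_conjugatable_field ^ 'n"
  assumes "is_upper_riesz_bound matrix_scale M (\<lambda>i. outer_product (\<phi> i) (\<phi> i)) B"
  shows "(norm (frame_operator M \<phi>))\<^sup>2 \<le> B * real M"
proof -
  have "matrix_scale 1 X = X" for X :: "'a ^ 'n ^ 'n"
    by (simp add: vec_eq_iff matrix_scale_def map_matrix_def)
  with assms[unfolded is_upper_riesz_bound_def, rule_format, of "\<lambda>_. 1"] show ?thesis
    by (simp add: frame_operator_def)
qed

text \<open>
  The Gram matrix of the outer products is entrywise \<open>\<bar>\<langle>\<phi> i, \<phi> j\<rangle>\<bar>\<^sup>2\<close>, because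
  \<open>\<langle>x x\<^sup>*, y y\<^sup>*\<rangle> = \<langle>x, y\<rangle> \<langle>y, x\<rangle>\<close>.
\<close>

lemma norm_sum_outer_products:
  fixes \<phi> :: "nat \<Rightarrow> 'a::normed_conjugatable_field ^ 'n"
  assumes "finite I"
  shows "of_real ((norm (\<Sum>i\<in>I. matrix_scale (a i) (outer_product (\<phi> i) (\<phi> i))))\<^sup>2)
    = (\<Sum>i\<in>I. \<Sum>j\<in>I. a i * conjugate (a j) * of_real ((norm (hinner (\<phi> i) (\<phi> j)))\<^sup>2))"
proof -
  let ?T = "\<Sum>i\<in>I. matrix_scale (a i) (outer_product (\<phi> i) (\<phi> i))"
  let ?t = "\<lambda>k l i j. a i * conjugate (a j)
    * (\<phi> i $ k * conjugate (\<phi> j $ k) * (conjugate (\<phi> i $ l) * \<phi> j $ l))"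
  have "(of_real ((norm ?T)\<^sup>2) :: 'a)
      = (\<Sum>k\<in>UNIV. \<Sum>l\<in>UNIV. ?T $ k $ l * conjugate (?T $ k $ l))"
    by (simp only: norm_matrix_squared of_real_sum mult_conjugate)
  also have "\<dots> = (\<Sum>k\<in>UNIV. \<Sum>l\<in>UNIV. \<Sum>i\<in>I. \<Sum>j\<in>I. ?t k l i j)"
    unfolding sum_matrix_scale_outer_nth sum_conjugate[OF assms] sum_product
    by (simp only: conjugate_dist_mul conjugate_id mult_ac)
  also have "\<dots> = (\<Sum>k\<in>UNIV. \<Sum>i\<in>I. \<Sum>l\<in>UNIV. \<Sum>j\<in>I. ?t k l i j)"
    by (intro sum.cong refl sum.swap)
  also have "\<dots> = (\<Sum>i\<in>I. \<Sum>k\<in>UNIV. \<Sum>l\<in>UNIV. \<Sum>j\<in>I. ?t k l i j)"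
    by (rule sum.swap)
  also have "\<dots> = (\<Sum>i\<in>I. \<Sum>k\<in>UNIV. \<Sum>j\<in>I. \<Sum>l\<in>UNIV. ?t k l i j)"
    by (intro sum.cong refl sum.swap)
  also have "\<dots> = (\<Sum>i\<in>I. \<Sum>j\<in>I. \<Sum>k\<in>UNIV. \<Sum>l\<in>UNIV. ?t k l i j)"
    by (intro sum.cong refl sum.swap)
  also have "\<dots> = (\<Sum>i\<in>I. \<Sum>j\<in>I. a i * conjugate (a j)
      * (hinner (\<phi> i) (\<phi> j) * conjugate (hinner (\<phi> i) (\<phi> j))))"
    unfolding hinner_def sum_conjugate[OF finite] sum_product
    by (simp only: conjugate_dist_mul conjugate_id sum_distrib_left)
  finally show ?thesis by (simp only: mult_conjugate)
qed

lemma hinner_commute: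
  fixes x y :: "'a::normed_conjugatable_field ^ 'n"
  shows "hinner y x = conjugate (hinner x y)"
  by (simp add: hinner_def sum_conjugate conjugate_dist_mul mult.commute)

text \<open>
  Schur's test for a symmetric kernel: \<open>2 u i u j \<le> (u i)\<^sup>2 + (u j)\<^sup>2\<close> moves all
  the weight onto the row sums.
\<close>

lemma schur_test_symmetric:
  fixes K :: "'i \<Rightarrow> 'i \<Rightarrow> real"
  assumes nonneg: "\<And>i j. i \<in> I \<Longrightarrow> j \<in> I \<Longrightarrow> 0 \<le> K i j"
    and sym: "\<And>i j. i \<in> I \<Longrightarrow> j \<in> I \<Longrightarrow> K i j = K j i"
    and row: "\<And>i. i \<in> I \<Longrightarrow> (\<Sum>j\<in>I. K i j) \<le> A"
  shows "(\<Sum>i\<in>I. \<Sum>j\<in>I. u i * u j * K i j) \<le> A * (\<Sum>i\<in>I. (u i)\<^sup>2)"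
proof -
  let ?R = "\<Sum>i\<in>I. \<Sum>j\<in>I. (u i)\<^sup>2 * K i j"
  have "u i * u j * K i j \<le> ((u i)\<^sup>2 * K i j + (u j)\<^sup>2 * K i j) / 2"
    if "i \<in> I" "j \<in> I" for i j
  proof -
    have "2 * u i * u j * K i j \<le> ((u i)\<^sup>2 + (u j)\<^sup>2) * K i j"
      by (intro mult_right_mono sum_squares_bound nonneg that)
    then show ?thesis by (simp add: algebra_simps)
  qed
  then have "(\<Sum>i\<in>I. \<Sum>j\<in>I. u i * u j * K i j)
      \<le> (\<Sum>i\<in>I. \<Sum>j\<in>I. ((u i)\<^sup>2 * K i j + (u j)\<^sup>2 * K i j) / 2)"
    by (intro sum_mono)
  also have "\<dots> = (?R + (\<Sum>i\<in>I. \<Sum>j\<in>I. (u j)\<^sup>2 * K i j)) / 2"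
    by (simp add: sum.distrib add_divide_distrib flip: sum_divide_distrib)
  also have "(\<Sum>i\<in>I. \<Sum>j\<in>I. (u j)\<^sup>2 * K i j) = (\<Sum>j\<in>I. \<Sum>i\<in>I. (u j)\<^sup>2 * K i j)"
    by (rule sum.swap)
  also have "\<dots> = ?R"
    by (intro sum.cong refl) (simp add: sym)
  also have "(?R + ?R) / 2 = ?R"
    by simp
  also have "\<dots> = (\<Sum>i\<in>I. (u i)\<^sup>2 * (\<Sum>j\<in>I. K i j))"
    by (simp add: sum_distrib_left)
  also have "\<dots> \<le> (\<Sum>i\<in>I. (u i)\<^sup>2 * A)"
    by (intro sum_mono mult_left_mono row) auto
  also have "\<dots> = A * (\<Sum>i\<in>I. (u i)\<^sup>2)"
    by (simp add: sum_distrib_left mult.commute)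
  finally show ?thesis .
qed

text \<open>
  The upper frame inequality at the unit vector \<open>\<phi> i\<close> bounds the row sums of the Gram matrix
  of the outer products.
\<close>

lemma upper_riesz_bound_if_frame_bounds:
  fixes \<phi> :: "nat \<Rightarrow> 'a::normed_conjugatable_field ^ 'n"
  assumes frame: "frame_bounds M \<phi> A B" and unit: "unit_norm M \<phi>"
  shows "is_upper_riesz_bound matrix_scale M (\<lambda>i. outer_product (\<phi> i) (\<phi> i)) B"
  unfolding is_upper_riesz_bound_def
proof
  fix a :: "nat \<Rightarrow> 'a"
  let ?I = "{1..M}"
  let ?T = "\<Sum>i\<in>?I. matrix_scale (a i) (outer_product (\<phi> i) (\<phi> i))"
  let ?K = "\<lambda>i j. (norm (hinner (\<phi> i) (\<phi> j)))\<^sup>2"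
  have sym: "?K i j = ?K j i" for i j
    by (metis hinner_commute norm_conjugate)
  have row: "(\<Sum>j\<in>?I. ?K i j) \<le> B" if "i \<in> ?I" for i
  proof -
    have "(\<Sum>j\<in>?I. ?K j i) \<le> B * (norm (\<phi> i))\<^sup>2"
      using frame by (simp add: frame_bounds_def)
    with that unit show ?thesis by (simp add: unit_norm_def sym[of i])
  qed
  have "(norm ?T)\<^sup>2 = norm (of_real ((norm ?T)\<^sup>2) :: 'a)"
    by (simp only: norm_of_real abs_of_nonneg zero_le_power2)
  also have "\<dots> \<le> (\<Sum>i\<in>?I. \<Sum>j\<in>?I. norm (a i * conjugate (a j) * of_real (?K i j)))"
    unfolding norm_sum_outer_products[OF finite_atLeastAtMost] by (intro sum_norm_le order_refl)
  also have "\<dots> = (\<Sum>i\<in>?I. \<Sum>j\<in>?I. norm (a i) * norm (a j) * ?K i j)"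
    by (simp add: norm_mult norm_power)
  also have "\<dots> \<le> B * (\<Sum>i\<in>?I. (norm (a i))\<^sup>2)"
    by (rule schur_test_symmetric) (use sym row in \<open>blast intro: zero_le_power2\<close>)+
  finally show "(norm ?T)\<^sup>2 \<le> B * (\<Sum>i=1..M. (norm (a i))\<^sup>2)" .
qed

section \<open>Frame bounds on the standard basis\<close>

text \<open>
  Summing a frame inequality over an orthonormal basis compares \<open>N\<close> times the frame bound
  with \<open>\<Sum>i. \<parallel>\<phi> i\<parallel>\<^sup>2 = M\<close>.
\<close>

lemma frame_bounds_unit_norm:
  fixes \<phi> :: "nat \<Rightarrow> 'a::normed_conjugatable_field ^ 'n"
  assumes frame: "frame_bounds M \<phi> A B" and unit: "unit_norm M \<phi>"
  shows "A \<le> real M / real CARD('n)" and "real M / real CARD('n) \<le> B"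
proof -
  define e :: "'n \<Rightarrow> 'a ^ 'n" where "e k = axis k 1" for k
  have norm_e: "(norm (e k))\<^sup>2 = 1" for k
  proof -
    have "(norm (e k))\<^sup>2 = (\<Sum>i\<in>UNIV. if i = k then 1 else 0)"
      unfolding norm_vec_squared e_def by (intro sum.cong) (auto simp: axis_def)
    then show ?thesis by simp
  qed
  have inner_e: "norm (hinner x (e k)) = norm (x $ k)" for x k
  proof -
    have "hinner x (e k) = (\<Sum>i\<in>UNIV. if i = k then x $ i * conjugate 1 else 0)"
      unfolding hinner_def e_def by (intro sum.cong) (auto simp: axis_def)
    then show ?thesis by (simp add: norm_mult)
  qed
  have "A \<le> (\<Sum>i=1..M. (norm (\<phi> i $ k))\<^sup>2) \<and> (\<Sum>i=1..M. (norm (\<phi> i $ k))\<^sup>2) \<le> B" for k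
    using frame[unfolded frame_bounds_def, THEN conjunct2, THEN conjunct2, rule_format, of "e k"]
    by (simp add: inner_e norm_e)
  then have "(\<Sum>k\<in>(UNIV::'n set). A) \<le> real M" "real M \<le> (\<Sum>k\<in>(UNIV::'n set). B)"
    unfolding sum_coordinates_unit_norm[OF unit, symmetric] by (blast intro: sum_mono)+
  then show "A \<le> real M / real CARD('n)" "real M / real CARD('n) \<le> B"
    by (simp_all add: field_simps)
qed

section \<open>The optimal upper Riesz bound\<close>

theorem upper_riesz_bound_outer_products:
  fixes \<phi> :: "nat \<Rightarrow> 'a::normed_conjugatable_field ^ 'n"
  assumes frame: "is_frame M \<phi>" and unit: "unit_norm M \<phi>"
  defines "R \<equiv> upper_riesz_bound matrix_scale M (\<lambda>i. outer_product (\<phi> i) (\<phi> i))"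
    and "c \<equiv> real M / real CARD('n)"
  shows "c \<le> R" and "R = c \<longleftrightarrow> is_tight_frame M \<phi>"
proof -
  let ?S = "frame_operator M \<phi>"
  obtain A B where AB: "frame_bounds M \<phi> A B"
    using frame unfolding is_frame_def by blast
  have "0 < A" using AB by (simp add: frame_bounds_def)
  then have "c > 0"
    using frame_bounds_unit_norm(1)[OF AB unit] by (simp add: c_def)
  then have "M \<ge> 1" by (cases M) (auto simp: c_def)
  note least = upper_riesz_bound_is_least[OF norm_matrix_scale \<open>M \<ge> 1\<close>,
      where x = "\<lambda>i. outer_product (\<phi> i) (\<phi> i)", folded R_def]
  have key: "c * real M + (norm (?S - mat (of_real c)))\<^sup>2 \<le> R * real M"
    using upper_riesz_bound_frame_operator[OF least(1)] norm_frame_operator[OF unit]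
    by (simp add: c_def power2_eq_square)
  then have "c * real M \<le> R * real M"
    by (smt (verit) zero_le_power2)
  with \<open>M \<ge> 1\<close> show "c \<le> R" by simp
  show "R = c \<longleftrightarrow> is_tight_frame M \<phi>"
  proof
    assume "R = c"
    with key have "?S = mat (of_real c)" by simp
    from frame_bounds_if_frame_operator_scalar[OF this \<open>c > 0\<close>]
    show "is_tight_frame M \<phi>" unfolding is_tight_frame_def by blast
  next
    assume "is_tight_frame M \<phi>"
    then obtain D where D: "frame_bounds M \<phi> D D"
      unfolding is_tight_frame_def by blast
    have "D = c"
      using frame_bounds_unit_norm[OF D unit] by (simp add: c_def)
    then have "R \<le> c"
      using least(2)[OF upper_riesz_bound_if_frame_bounds[OF D unit]] by simp
    with \<open>c \<le> R\<close> show "R = c" by simp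
  qed
qed

theorem theorem4p4:
  shows "(\<forall>(M::nat) (\<phi> :: nat \<Rightarrow> real ^ 'n).
            is_frame M \<phi> \<and> unit_norm M \<phi> \<longrightarrow>
              upper_riesz_bound matrix_scale M (\<lambda>i. outer_product (\<phi> i) (\<phi> i))
                \<ge> real M / real CARD('n) \<and>
              (upper_riesz_bound matrix_scale M (\<lambda>i. outer_product (\<phi> i) (\<phi> i))
                = real M / real CARD('n)
                \<longleftrightarrow> is_tight_frame M \<phi> \<and> unit_norm M \<phi>)) \<and>
         (\<forall>(M::nat) (\<phi> :: nat \<Rightarrow> complex ^ 'n).
            is_frame M \<phi> \<and> unit_norm M \<phi> \<longrightarrow>
              upper_riesz_bound matrix_scale M (\<lambda>i. outer_product (\<phi> i) (\<phi> i))
                \<ge> real M / real CARD('n) \<and>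
              (upper_riesz_bound matrix_scale M (\<lambda>i. outer_product (\<phi> i) (\<phi> i))
                = real M / real CARD('n)
                \<longleftrightarrow> is_tight_frame M \<phi> \<and> unit_norm M \<phi>))"
  using upper_riesz_bound_outer_products[where 'a = real and 'n = 'n]
    upper_riesz_bound_outer_products[where 'a = complex and 'n = 'n]
  by blast

end
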